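(* Let $G$ be a graph of order $n\ge 3$ and let $t$ be the number of vertices of degree $n-1$ in $G$. If $t\ge 1$, then $b_{\rm R}(G)=\lceil t/2\rceil$.
   Context: Graphs are finite, undirected, without loops or multiple edges; the order of a graph is its number of vertices; a graph is nonempty if it has at least one edge. A Roman dominating function on $G=(V,E)$ is a function $f:V\to\{0,1,2\}$ such that every vertex $x$ with $f(x)=0$ is adjacent to at least one vertex $y$ with $f(y)=2$. Its weight is $\sum_{u\in V}f(u)$. The Roman domination number $\gamma_{\rm R}(G)$ is the minimum weight of a Roman dominating function on $G$. The Roman bondage number of a nonempty graph $G$ is $b_{\rm R}(G)=\min\{|B|: B\subseteq E(G),\ \gamma_{\rm R}(G-B)>\gamma_{\rm R}(G)\}$, with $b_{\rm R}(G)=\infty$ if no such $B$ exists; here $G-B$ is obtained from $G$ by deleting the edges in $B$ (keeping all vertices). *)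

theory Defs
  imports Complex_Main "HOL-Library.Extended_Nat"
begin

text \<open>
  A graph is given by its vertex set \<open>V\<close> and its edge set \<open>E\<close>; an edge is the two-element set
  of its ends, so loops and multiple edges cannot occur.
\<close>

definition simple_graph :: "'a set \<Rightarrow> 'a set set \<Rightarrow> bool" where
  "simple_graph V E \<longleftrightarrow> finite V \<and> (\<forall>e\<in>E. e \<subseteq> V \<and> card e = 2)"

definition degree :: "'a set set \<Rightarrow> 'a \<Rightarrow> nat" where
  "degree E v = card {e \<in> E. v \<in> e}"

text \<open>Only the values of \<open>f\<close> on \<open>V\<close> matter here and in the weight.\<close>

definition roman_dominating :: "'a set \<Rightarrow> 'a set set \<Rightarrow> ('a \<Rightarrow> nat) \<Rightarrow> bool" where
  "roman_dominating V E f \<longleftrightarrow>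
     (\<forall>x\<in>V. f x \<in> {0, 1, 2}) \<and>
     (\<forall>x\<in>V. f x = 0 \<longrightarrow> (\<exists>y\<in>V. {x, y} \<in> E \<and> f y = 2))"

definition roman_weight :: "'a set \<Rightarrow> ('a \<Rightarrow> nat) \<Rightarrow> nat" where
  "roman_weight V f = (\<Sum>u\<in>V. f u)"

definition roman_domination_number :: "'a set \<Rightarrow> 'a set set \<Rightarrow> nat" where
  "roman_domination_number V E = (LEAST w. \<exists>f. roman_dominating V E f \<and> w = roman_weight V f)"

text \<open>
  The infimum in \<^typ>\<open>enat\<close> is the minimum if some \<open>B\<close> qualifies, and it is \<open>\<infinity>\<close> otherwise.
\<close>

definition roman_bondage_number :: "'a set \<Rightarrow> 'a set set \<Rightarrow> enat" where
  "roman_bondage_number V E =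
     (INF B \<in> {B. B \<subseteq> E \<and> roman_domination_number V (E - B) > roman_domination_number V E}.
        enat (card B))"

end

theory Submission
  imports Defs
begin

text \<open>
  On at least three vertices every Roman dominating function has weight at least 2. Weight 2 leaves
  some vertex with value 0, so the whole weight sits on one neighbour of it, which has to dominate
  everything else. Hence the Roman domination number is 2 exactly when some vertex is
  adjacent to all others (\<open>roman_domination_number_eq_2\<close>,
  \<open>roman_domination_number_ge_3\<close>).

  If a graph has such a universal vertex, deleting \<open>B\<close> therefore raises the Roman domination number
  exactly when it leaves no universal vertex (\<open>roman_domination_number_increases_iff\<close>). Deletion
  never creates one, and it destroys the universal vertex \<open>v\<close> exactly when \<open>B\<close> has an edge at
  \<open>v\<close>. The bondage number is thus the least size of an edge set covering the
  set \<open>T\<close> of the \<open>t\<close> universal vertices. An edge covers at most two of them, so at least \<open>t / 2\<close>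
  edges are needed (\<open>card_le_twice_edge_cover\<close>); and since \<open>T\<close> is a clique, pairing its vertices (and joining a leftover one to
  any other vertex) reaches that bound up to rounding (\<open>small_edge_cover\<close>).
\<close>

definition universal_vertex :: "'a set \<Rightarrow> 'a set set \<Rightarrow> 'a \<Rightarrow> bool" where
  "universal_vertex V E v \<longleftrightarrow> v \<in> V \<and> (\<forall>x\<in>V. x \<noteq> v \<longrightarrow> {x, v} \<in> E)"

lemma simple_graph_delete_edges:
  "simple_graph V E \<Longrightarrow> simple_graph V (E - B)"
  by (auto simp: simple_graph_def)

lemma universal_vertex_mono:
  "universal_vertex V E v \<Longrightarrow> E \<subseteq> E' \<Longrightarrow> universal_vertex V E' v"
  by (auto simp: universal_vertex_def)

lemma edge_other_end:
  assumes "simple_graph V E" "e \<in> E" "v \<in> e"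
  obtains x where "x \<in> V" "x \<noteq> v" "e = {x, v}"
proof -
  from assms have "e \<subseteq> V" "card e = 2" by (auto simp: simple_graph_def)
  with \<open>v \<in> e\<close> that show thesis by (auto simp: card_2_iff)
qed

text \<open>
  The possible edges at \<open>v\<close> are the \<open>card V - 1\<close> sets \<open>{x, v}\<close> with \<open>x \<noteq> v\<close>, so the degree
  reaches this number only if all of them are present.
\<close>

lemma degree_eq_max_iff_universal:
  assumes "simple_graph V E" "v \<in> V"
  shows "degree E v = card V - 1 \<longleftrightarrow> universal_vertex V E v"
proof -
  let ?star = "(\<lambda>x. {x, v}) ` (V - {v})"
  have fin: "finite V" using assms by (simp add: simple_graph_def)
  have inj: "inj_on (\<lambda>x. {x, v}) (V - {v})"
    by (auto simp: inj_on_def doubleton_eq_iff)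
  have card_star: "card ?star = card V - 1"
    using fin assms(2) by (simp add: card_image[OF inj])
  have sub: "{e \<in> E. v \<in> e} \<subseteq> ?star"
    by (auto elim: edge_other_end[OF assms(1)])
  have "degree E v = card V - 1 \<longleftrightarrow> {e \<in> E. v \<in> e} = ?star"
    unfolding degree_def using card_subset_eq[OF _ sub] card_star fin by auto
  also have "\<dots> \<longleftrightarrow> universal_vertex V E v"
    using sub assms(2) by (auto simp: universal_vertex_def)
  finally show ?thesis .
qed

lemma roman_domination_number_attained:
  obtains f where "roman_dominating V E f"
    and "roman_weight V f = roman_domination_number V E"
proof -
  have "roman_dominating V E (\<lambda>_. 1)" by (simp add: roman_dominating_def)
  then have "\<exists>w f. roman_dominating V E f \<and> w = roman_weight V f" by blast
  from LeastI_ex[OF this] that show thesis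
    unfolding roman_domination_number_def by metis
qed

lemma roman_domination_number_le:
  "roman_dominating V E f \<Longrightarrow> roman_domination_number V E \<le> roman_weight V f"
  unfolding roman_domination_number_def by (rule Least_le) blast

text \<open>
  Without a zero, \<open>f\<close> already has weight \<open>card V\<close>; a zero forces a neighbour of value 2.
\<close>

lemma roman_weight_small_cases:
  assumes "finite V" "roman_dominating V E f"
  shows "roman_weight V f \<ge> card V \<or> (\<exists>y\<in>V. f y = 2)"
proof (cases "\<exists>x\<in>V. f x = 0")
  case True
  then show ?thesis using assms(2) by (auto simp: roman_dominating_def)
next
  case False
  then have "(\<Sum>x\<in>V. 1) \<le> (\<Sum>x\<in>V. f x)" by (intro sum_mono) (simp add: Suc_le_eq)
  then show ?thesis by (simp add: roman_weight_def)
qed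

lemma roman_weight_ge_2:
  assumes "finite V" "card V \<ge> 2" "roman_dominating V E f"
  shows "roman_weight V f \<ge> 2"
proof -
  have "roman_weight V f \<ge> 2" if "y \<in> V" "f y = 2" for y
    using member_le_sum[of y V f] assms(1) that by (simp add: roman_weight_def)
  then show ?thesis using roman_weight_small_cases[OF assms(1,3)] assms(2) by auto
qed

text \<open>
  A vertex of value 2 uses up the whole weight, so every other vertex has value 0 and can only be
  dominated by it.
\<close>

lemma universal_vertex_of_weight_le_2:
  assumes "finite V" "card V \<ge> 3" "roman_dominating V E f" "roman_weight V f \<le> 2"
  shows "\<exists>v. universal_vertex V E v"
proof -
  obtain y where y: "y \<in> V" "f y = 2"
    using roman_weight_small_cases[OF assms(1,3)] assms(2,4) by auto
  have "roman_weight V f = f y + sum f (V - {y})"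
    unfolding roman_weight_def using assms(1) y(1) by (rule sum.remove)
  then have "sum f (V - {y}) = 0" using y(2) assms(4) by simp
  then have zero: "f x = 0" if "x \<in> V" "x \<noteq> y" for x
    using assms(1) that by simp
  have "{x, y} \<in> E" if x: "x \<in> V" "x \<noteq> y" for x
  proof -
    obtain z where "z \<in> V" "{x, z} \<in> E" "f z = 2"
      using assms(3) zero[OF x] x(1) by (auto simp: roman_dominating_def)
    moreover from this have "z = y" using zero by fastforce
    ultimately show ?thesis by simp
  qed
  then show ?thesis using y(1) by (auto simp: universal_vertex_def)
qed

lemma roman_domination_number_eq_2:
  assumes "finite V" "card V \<ge> 2" "universal_vertex V E v"
  shows "roman_domination_number V E = 2"
proof (rule antisym)
  let ?f = "\<lambda>x. if x = v then 2 else 0 :: nat"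
  have "roman_dominating V E ?f" "v \<in> V"
    using assms(3) by (auto simp: roman_dominating_def universal_vertex_def)
  moreover have "roman_weight V ?f = 2"
    using assms(1) \<open>v \<in> V\<close> by (simp add: roman_weight_def)
  ultimately show "roman_domination_number V E \<le> 2"
    using roman_domination_number_le by metis
next
  show "2 \<le> roman_domination_number V E"
    by (metis roman_domination_number_attained roman_weight_ge_2[OF assms(1,2)])
qed

lemma roman_domination_number_ge_3:
  assumes "finite V" "card V \<ge> 3" "\<nexists>v. universal_vertex V E v"
  shows "roman_domination_number V E \<ge> 3"
proof -
  obtain f where f: "roman_dominating V E f" "roman_weight V f = roman_domination_number V E"
    by (rule roman_domination_number_attained)
  then have "\<not> roman_weight V f \<le> 2"
    using universal_vertex_of_weight_le_2[OF assms(1,2)] assms(3) by blast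
  with f(2) show ?thesis by simp
qed

lemma universal_vertex_delete_edges_iff:
  assumes "simple_graph V E" "universal_vertex V E v" "B \<subseteq> E"
  shows "universal_vertex V (E - B) v \<longleftrightarrow> v \<notin> \<Union>B"
proof
  assume univ: "universal_vertex V (E - B) v"
  show "v \<notin> \<Union>B"
  proof
    assume "v \<in> \<Union>B"
    then obtain e where e: "e \<in> B" "v \<in> e" by blast
    then obtain x where "x \<in> V" "x \<noteq> v" "e = {x, v}"
      using edge_other_end[OF assms(1)] assms(3) by blast
    with univ e(1) show False by (auto simp: universal_vertex_def)
  qed
next
  assume "v \<notin> \<Union>B"
  with assms(2) show "universal_vertex V (E - B) v"
    by (auto simp: universal_vertex_def)
qed

lemma roman_domination_number_increases_iff:
  assumes graph: "simple_graph V E" and "card V \<ge> 3" "\<exists>v. universal_vertex V E v" "B \<subseteq> E"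
  shows "roman_domination_number V (E - B) > roman_domination_number V E
    \<longleftrightarrow> {v. universal_vertex V E v} \<subseteq> \<Union>B"
proof -
  have fin: "finite V" using graph by (simp add: simple_graph_def)
  have "roman_domination_number V E = 2"
    using roman_domination_number_eq_2[OF fin] assms(2,3) by fastforce
  then have "roman_domination_number V (E - B) > roman_domination_number V E
      \<longleftrightarrow> (\<nexists>v. universal_vertex V (E - B) v)"
    using roman_domination_number_eq_2[OF fin, of "E - B"]
      roman_domination_number_ge_3[OF fin assms(2), of "E - B"] assms(2) by fastforce
  also have "\<dots> \<longleftrightarrow> {v. universal_vertex V E v} \<subseteq> \<Union>B"
    using universal_vertex_delete_edges_iff[OF graph _ assms(4)]
      universal_vertex_mono[of V "E - B" _ E] by blast
  finally show ?thesis .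
qed

lemma card_le_twice_edge_cover:
  assumes "simple_graph V E" "B \<subseteq> E" "finite B" "T \<subseteq> \<Union>B"
  shows "card T \<le> 2 * card B"
proof -
  have edge: "finite e \<and> card e = 2" if "e \<in> B" for e
    using assms(1,2) that by (auto simp: simple_graph_def card_2_iff)
  have "card T \<le> card (\<Union>B)"
    using assms(3,4) edge by (intro card_mono) auto
  also have "\<dots> \<le> sum card B" by (rule card_Union_le_sum_card)
  also have "\<dots> = 2 * card B" using edge by simp
  finally show ?thesis .
qed

text \<open>
  Greedy pairing: two universal vertices are adjacent, so one edge disposes of both. A single
  remaining one still needs an edge of its own, whence the rounding up and the hypothesis that \<open>V\<close>
  has a second vertex.
\<close>

lemma small_edge_cover:
  assumes "card V \<ge> 2" "finite T" "\<forall>v\<in>T. universal_vertex V E v"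
  shows "\<exists>B\<subseteq>E. finite B \<and> T \<subseteq> \<Union>B \<and> card B \<le> (card T + 1) div 2"
  using assms(2,3)
proof (induction T rule: finite_psubset_induct)
  case (psubset T)
  show ?case
  proof (cases "card T \<le> 1")
    case True
    show ?thesis
    proof (cases "T = {}")
      case True
      then show ?thesis by (intro exI[of _ "{}"]) simp
    next
      case False
      with True psubset.hyps have "card T = 1"
        by (metis One_nat_def card_0_eq le_SucE le_zero_eq)
      then obtain v where T: "T = {v}" by (auto simp: card_1_singleton_iff)
      have "\<not> V \<subseteq> {v}" using assms(1) card_mono[of "{v}" V] by auto
      then obtain x where "x \<in> V" "x \<noteq> v" by blast
      with psubset.prems T have "{x, v} \<in> E" by (auto simp: universal_vertex_def)
      with T show ?thesis by (intro exI[of _ "{{x, v}}"]) auto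
    qed
  next
    case False
    then obtain u v where uv: "u \<in> T" "v \<in> T" "u \<noteq> v"
      using card_le_Suc0_iff_eq[of T] psubset.hyps by auto
    let ?T = "T - {u, v}"
    have "card ?T = card T - 2"
      using uv psubset.hyps by (simp add: card_Diff_subset)
    with False have card_T: "card T = card ?T + 2" by simp
    have "?T \<subset> T" using uv by blast
    then obtain B where B: "B \<subseteq> E" "finite B" "?T \<subseteq> \<Union>B" "card B \<le> (card ?T + 1) div 2"
      using psubset.IH psubset.prems by (metis Diff_iff)
    have "{u, v} \<in> E" using psubset.prems uv by (auto simp: universal_vertex_def)
    moreover have "card (insert {u, v} B) \<le> (card T + 1) div 2"
      using B(2,4) card_T by (simp add: card_insert_if)
    ultimately show ?thesis
      using B by (intro exI[of _ "insert {u, v} B"]) auto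
  qed
qed

theorem lemma3p1:
  fixes V :: "'a set" and E :: "'a set set" and n t :: nat
  assumes "simple_graph V E"
    and "n = card V" and "n \<ge> 3"
    and "t = card {v \<in> V. degree E v = n - 1}"
    and "t \<ge> 1"
  shows "roman_bondage_number V E = enat (nat \<lceil>real t / 2\<rceil>)"
proof -
  define T where "T = {v. universal_vertex V E v}"
  have fin: "finite V" "finite E"
    using assms(1) finite_subset[of E "Pow V"] by (auto simp: simple_graph_def)
  have "{v \<in> V. degree E v = n - 1} = T"
    using degree_eq_max_iff_universal[OF assms(1)] assms(2)
    by (auto simp: T_def universal_vertex_def)
  with assms(4) have t: "t = card T" by simp
  have "T \<subseteq> V" by (auto simp: T_def universal_vertex_def)
  with fin have finT: "finite T" by (simp add: finite_subset)
  have "T \<noteq> {}" using t assms(5) by auto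
  then have "\<exists>v. universal_vertex V E v" by (simp add: T_def)
  then have "{B. B \<subseteq> E \<and> roman_domination_number V (E - B) > roman_domination_number V E}
      = {B. B \<subseteq> E \<and> T \<subseteq> \<Union>B}"
    using roman_domination_number_increases_iff[OF assms(1)] assms(2,3)
    unfolding T_def by blast
  then have bondage: "roman_bondage_number V E = (INF B \<in> {B. B \<subseteq> E \<and> T \<subseteq> \<Union>B}. enat (card B))"
    by (simp only: roman_bondage_number_def)
  have "nat \<lceil>real t / 2\<rceil> = (t + 1) div 2" by linarith
  moreover have "roman_bondage_number V E = enat ((t + 1) div 2)"
  proof (rule antisym)
    have "card V \<ge> 2" "\<forall>v\<in>T. universal_vertex V E v"
      using assms(2,3) by (simp_all add: T_def)
    from small_edge_cover[OF this(1) finT this(2)]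
    obtain B where "B \<subseteq> E" "T \<subseteq> \<Union>B" "card B \<le> (t + 1) div 2"
      unfolding t by blast
    then show "roman_bondage_number V E \<le> enat ((t + 1) div 2)"
      unfolding bondage by (intro INF_lower2[of B]) auto
  next
    show "enat ((t + 1) div 2) \<le> roman_bondage_number V E"
      unfolding bondage
    proof (rule INF_greatest)
      fix B assume "B \<in> {B. B \<subseteq> E \<and> T \<subseteq> \<Union>B}"
      then have "t \<le> 2 * card B"
        using card_le_twice_edge_cover[OF assms(1)] fin(2) t
        by (simp add: finite_subset)
      then show "enat ((t + 1) div 2) \<le> enat (card B)" by simp
    qed
  qed
  ultimately show ?thesis by simp
qed

end
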